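(* Consider a Vector-Max-GAP instance with item set $I$, $k$ machines of capacities $M_1,\dots,M_k$, sizes $s_j(i)$, values $\mathrm{val}_j(i)$, weights $\vec w(i)=(w_1(i),\dots,w_d(i))$ and global weight bound vector $\vec W=(W_1,\dots,W_d)$. Let $J$ be a feasible solution, with $J_j\subseteq J$ the items assigned to machine $j$. Then for every $\epsilon>0$ there exist sets $X$ and $Y$ such that $|X|\le (d+k)/\epsilon^2$, $\mathrm{val}(Y)\le\epsilon\cdot\mathrm{val}(J)$, and $$\forall j\in[k],\ \forall i\in J_j\setminus(X\cup Y):\ s_j(i)\le \epsilon\big(M_j-s_j(X\cap J_j)\big),$$ $$\forall i\in J\setminus(X\cup Y):\ \vec w(i)\le \epsilon\big(\vec W-\vec w(X)\big)\ \text{(componentwise)}.$$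
   Context: Vector-Max-GAP: items $I$, $k$ machines; machine $j$ has capacity $M_j\ge0$; item $i$ has size $s_j(i)\ge 0$ and value $\mathrm{val}_j(i)\ge0$ on machine $j$, and weight $w_q(i)\ge 0$ for $q\in[d]$. A feasible solution is $J\subseteq I$ with a partition $J=J_1\cup\dots\cup J_k$ such that $\sum_{i\in J_j}s_j(i)\le M_j$ and $\sum_{i\in J}w_q(i)\le W_q$ for all $j,q$. For a set $S$, $s_j(S)=\sum_{i\in S}s_j(i)$, $\vec w(S)=\sum_{i\in S}\vec w(i)$, and $\mathrm{val}(J)=\sum_j\sum_{i\in J_j}\mathrm{val}_j(i)$ (for subsets of $J$, values are taken with respect to the machines the items are assigned to in $J$). *)

theory Defs
  imports Complex_Main "HOL-Library.Disjoint_Sets"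
begin

text \<open>Machines are indexed by \<open>{1..num_machines}\<close> and weight dimensions by \<open>{1..num_dims}\<close>;
  size, value and weight functions are meaningful only at these indices and on \<open>items\<close>.\<close>

record 'a vmgap =
  items :: "'a set"
  num_machines :: nat
  num_dims :: nat
  capacity :: "nat \<Rightarrow> real"
  item_size :: "nat \<Rightarrow> 'a \<Rightarrow> real"
  item_val :: "nat \<Rightarrow> 'a \<Rightarrow> real"
  item_weight :: "nat \<Rightarrow> 'a \<Rightarrow> real"
  weight_bound :: "nat \<Rightarrow> real"

definition machines :: "'a vmgap \<Rightarrow> nat set" where
  "machines V = {1..num_machines V}"

definition dims :: "'a vmgap \<Rightarrow> nat set" where
  "dims V = {1..num_dims V}"

definition vmgap_instance :: "'a vmgap \<Rightarrow> bool" where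
  "vmgap_instance V \<longleftrightarrow>
     finite (items V) \<and>
     (\<forall>j\<in>machines V. capacity V j \<ge> 0) \<and>
     (\<forall>j\<in>machines V. \<forall>i\<in>items V. item_size V j i \<ge> 0 \<and> item_val V j i \<ge> 0) \<and>
     (\<forall>q\<in>dims V. \<forall>i\<in>items V. item_weight V q i \<ge> 0)"

definition set_size :: "'a vmgap \<Rightarrow> nat \<Rightarrow> 'a set \<Rightarrow> real" where
  "set_size V j S = (\<Sum>i\<in>S. item_size V j i)"

definition set_weight :: "'a vmgap \<Rightarrow> nat \<Rightarrow> 'a set \<Rightarrow> real" where
  "set_weight V q S = (\<Sum>i\<in>S. item_weight V q i)"

text \<open>A solution is a set \<open>J\<close> with the family \<open>P\<close> of its parts, \<open>P j\<close> being the items assigned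
  to machine \<open>j\<close>; parts may be empty.\<close>

definition feasible :: "'a vmgap \<Rightarrow> 'a set \<Rightarrow> (nat \<Rightarrow> 'a set) \<Rightarrow> bool" where
  "feasible V J P \<longleftrightarrow>
     J \<subseteq> items V \<and>
     J = (\<Union>j\<in>machines V. P j) \<and>
     disjoint_family_on P (machines V) \<and>
     (\<forall>j\<in>machines V. set_size V j (P j) \<le> capacity V j) \<and>
     (\<forall>q\<in>dims V. set_weight V q J \<le> weight_bound V q)"

text \<open>Value of a subset \<open>S\<close> of a solution, with respect to the assignment \<open>P\<close> of that solution.\<close>

definition set_val :: "'a vmgap \<Rightarrow> (nat \<Rightarrow> 'a set) \<Rightarrow> 'a set \<Rightarrow> real" where
  "set_val V P S = (\<Sum>j\<in>machines V. \<Sum>i\<in>S \<inter> P j. item_val V j i)"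

end

theory Submission
  imports Defs
begin

text \<open>Grow \<open>X\<close> greedily from the empty set: in each round, add all items that are too large for
  some constraint relative to its residual capacity. A round adds at most \<open>1/\<epsilon>\<close> items per
  constraint, since more would overflow the residual capacity. The items added in different rounds
  are disjoint, so among the first \<open>\<lceil>1/\<epsilon>\<rceil>\<close> rounds one adds items of total value at most an
  \<open>\<epsilon>\<close>-fraction; these items form \<open>Y\<close>, and \<open>X\<close> is what was collected strictly before that round,
  that is, in fewer than \<open>1/\<epsilon>\<close> rounds.\<close>

text \<open>Machine capacities and weight bounds are treated uniformly: \<open>c\<close> ranges over
  packing constraints, \<open>a c i\<close> is what item \<open>i\<close> consumes of
  \<open>c\<close>, and \<open>b c\<close> is the budget.\<close>

definition large_items ::
  "'a set \<Rightarrow> 'c set \<Rightarrow> ('c \<Rightarrow> 'a \<Rightarrow> real) \<Rightarrow> ('c \<Rightarrow> real) \<Rightarrow> real \<Rightarrow> 'a set \<Rightarrow> 'a set" where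
  "large_items J C a b \<epsilon> X = {i \<in> J - X. \<exists>c\<in>C. a c i > \<epsilon> * (b c - (\<Sum>x\<in>X. a c x))}"

lemma card_le_inverse_if_large:
  fixes f :: "'a \<Rightarrow> real"
  assumes "\<epsilon> > 0" and "sum f A \<le> r" and large: "\<And>i. i \<in> A \<Longrightarrow> f i > \<epsilon> * r"
    and nonneg: "\<And>i. i \<in> A \<Longrightarrow> f i \<ge> 0"
  shows "real (card A) \<le> 1 / \<epsilon>"
proof (cases "finite A \<and> A \<noteq> {}")
  \<comment> \<open>An infinite \<open>A\<close> belongs here too, since its \<open>card\<close> is
    0 by convention.\<close>
  case False
  then show ?thesis using \<open>\<epsilon> > 0\<close> by auto
next
  case True
  have "(\<Sum>i\<in>A. \<epsilon> * r) < sum f A"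
    using True large by (intro sum_strict_mono) auto
  then have less: "real (card A) * \<epsilon> * r < r"
    using assms(2) by simp
  have "r \<ge> 0"
    using sum_nonneg[of A f] nonneg assms(2) by force
  \<comment> \<open>For \<open>r = 0\<close> the strict inequality would read \<open>0 < 0\<close>;
    positivity allows cancelling \<open>r\<close>.\<close>
  then have "r > 0"
    using less by (cases "r = 0") auto
  then have "real (card A) * \<epsilon> < 1"
    using less by simp
  then show ?thesis
    using \<open>\<epsilon> > 0\<close> by (simp add: field_simps)
qed

lemma card_large_items_le:
  fixes a :: "'c \<Rightarrow> 'a \<Rightarrow> real"
  assumes "finite J" and "finite C" and "\<epsilon> > 0"
    and nonneg: "\<And>c i. c \<in> C \<Longrightarrow> i \<in> J \<Longrightarrow> a c i \<ge> 0"
    and bound: "\<And>c. c \<in> C \<Longrightarrow> sum (a c) J \<le> b c"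
    and "X \<subseteq> J"
  shows "real (card (large_items J C a b \<epsilon> X)) \<le> real (card C) / \<epsilon>"
proof -
  define L where "L c = {i \<in> J - X. a c i > \<epsilon> * (b c - (\<Sum>x\<in>X. a c x))}" for c
  have "real (card (L c)) \<le> 1 / \<epsilon>" if "c \<in> C" for c
  proof (rule card_le_inverse_if_large)
    \<comment> \<open>Since all of \<open>J\<close> respects the budget, whatever lies outside
      \<open>X\<close> fits into the residual budget; this is the overflow bound for constraint
      \<open>c\<close>.\<close>
    have "sum (a c) (L c) \<le> sum (a c) (J - X)"
      using assms(1) nonneg[OF that] by (intro sum_mono2) (auto simp: L_def)
    also have "\<dots> = sum (a c) J - sum (a c) X"
      using assms(1) \<open>X \<subseteq> J\<close> by (rule sum_diff)
    finally show "sum (a c) (L c) \<le> b c - sum (a c) X"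
      using bound[OF that] by simp
  qed (use nonneg that \<open>\<epsilon> > 0\<close> in \<open>auto simp: L_def\<close>)
  then have sum_le: "(\<Sum>c\<in>C. real (card (L c))) \<le> (\<Sum>c\<in>C. 1 / \<epsilon>)"
    by (rule sum_mono)
  have "large_items J C a b \<epsilon> X = (\<Union>c\<in>C. L c)"
    by (auto simp: large_items_def L_def)
  then have "real (card (large_items J C a b \<epsilon> X)) \<le> (\<Sum>c\<in>C. real (card (L c)))"
    using card_UN_le[OF \<open>finite C\<close>, of L] by (simp flip: of_nat_sum)
  with sum_le show ?thesis by simp
qed

lemma exists_small_large_items:
  fixes a :: "'c \<Rightarrow> 'a \<Rightarrow> real" and v :: "'a \<Rightarrow> real"
  assumes "finite J" and "finite C" and "\<epsilon> > 0"
    and nonneg: "\<And>c i. c \<in> C \<Longrightarrow> i \<in> J \<Longrightarrow> a c i \<ge> 0"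
    and bound: "\<And>c. c \<in> C \<Longrightarrow> sum (a c) J \<le> b c"
    and v_nonneg: "\<And>i. i \<in> J \<Longrightarrow> v i \<ge> 0"
  obtains X Y where "X \<subseteq> J" and "Y \<subseteq> J"
    and "real (card X) \<le> real (card C) / \<epsilon>\<^sup>2"
    and "sum v Y \<le> \<epsilon> * sum v J"
    and "\<And>c i. c \<in> C \<Longrightarrow> i \<in> J - (X \<union> Y) \<Longrightarrow> a c i \<le> \<epsilon> * (b c - sum (a c) X)"
proof -
  define K where "K = large_items J C a b \<epsilon>"
  \<comment> \<open>Rounds count from 0: \<open>X t\<close> is the collection before round
    \<open>t\<close>, and \<open>K (X t)\<close> is what that round adds.\<close>
  define X where "X t = ((\<lambda>S. S \<union> K S) ^^ t) {}" for t
  have X_0: "X 0 = {}" and X_Suc: "X (Suc t) = X t \<union> K (X t)" for t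
    by (simp_all add: X_def)
  have K_sub: "K S \<subseteq> J" and K_disj: "S \<inter> K S = {}" for S
    by (auto simp: K_def large_items_def)
  have X_sub: "X t \<subseteq> J" for t
    by (induction t) (use K_sub in \<open>auto simp: X_0 X_Suc\<close>)
  have fin: "finite S" if "S \<subseteq> J" for S
    using that \<open>finite J\<close> by (rule finite_subset)
  have card_X: "real (card (X t)) \<le> real t * (real (card C) / \<epsilon>)" for t
  proof (induction t)
    case (Suc t)
    have "real (card (K (X t))) \<le> real (card C) / \<epsilon>"
      unfolding K_def
      by (rule card_large_items_le) (use assms X_sub in auto)
    moreover have "real (card (X (Suc t))) \<le> real (card (X t)) + real (card (K (X t)))"
      using card_Un_le[of "X t" "K (X t)"] by (simp add: X_Suc flip: of_nat_add)
    ultimately show ?case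
      using Suc.IH unfolding of_nat_Suc distrib_right by linarith
  qed (simp add: X_0)
  have sum_X: "sum v (X n) = (\<Sum>t<n. sum v (K (X t)))" for n
    by (induction n)
      (simp_all add: X_0 X_Suc sum.union_disjoint fin X_sub K_sub K_disj)
  \<comment> \<open>The lower bound on \<open>n\<close> serves the averaging over rounds, the upper
    bound the cardinality of \<open>X t\<close> for \<open>t < n\<close>.\<close>
  define n where "n = nat \<lceil>1 / \<epsilon>\<rceil>"
  have n_pos: "n > 0" and n_ge: "real n \<ge> 1 / \<epsilon>" and n_less: "real n < 1 / \<epsilon> + 1"
    using \<open>\<epsilon> > 0\<close> unfolding n_def by (simp_all add: of_nat_ceiling) linarith
  have vJ: "sum v J \<ge> 0"
    using v_nonneg by (rule sum_nonneg)
  \<comment> \<open>Averaging: otherwise the \<open>n\<close> disjoint rounds, all inside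
    \<open>J\<close>, would together be worth more than \<open>n * \<epsilon> \<ge> 1\<close> times
    the value of \<open>J\<close>.\<close>
  have "\<exists>t<n. sum v (K (X t)) \<le> \<epsilon> * sum v J"
  proof (rule ccontr)
    assume "\<not> ?thesis"
    then have "(\<Sum>t<n. \<epsilon> * sum v J) < (\<Sum>t<n. sum v (K (X t)))"
      using n_pos by (intro sum_strict_mono) (auto simp: not_le)
    also have "\<dots> \<le> sum v J"
      unfolding sum_X[symmetric]
      using \<open>finite J\<close> X_sub v_nonneg by (intro sum_mono2) auto
    finally have "(real n * \<epsilon>) * sum v J < 1 * sum v J"
      by simp
    moreover have "1 \<le> real n * \<epsilon>"
      using n_ge \<open>\<epsilon> > 0\<close> by (simp add: field_simps)
    ultimately show False
      using mult_right_mono[OF _ vJ] by fastforce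
  qed
  then obtain t where "t < n" and t_val: "sum v (K (X t)) \<le> \<epsilon> * sum v J"
    by blast
  show thesis
  proof
    \<comment> \<open>As \<open>t \<le> n - 1\<close>, rounding up in \<open>n\<close> costs
      nothing: \<open>X t\<close> contains only the \<open>t\<close> rounds before the cheap
      one.\<close>
    have "real t \<le> 1 / \<epsilon>"
      using \<open>t < n\<close> n_less by linarith
    then have "real t * (real (card C) / \<epsilon>) \<le> 1 / \<epsilon> * (real (card C) / \<epsilon>)"
      using \<open>\<epsilon> > 0\<close> by (intro mult_right_mono) auto
    then show "real (card (X t)) \<le> real (card C) / \<epsilon>\<^sup>2"
      using card_X[of t] by (simp add: power2_eq_square)
    \<comment> \<open>\<open>K (X t)\<close> holds every item that is large relative to
      \<open>X t\<close>, so an item outside both is large for no constraint.\<close>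
    show "a c i \<le> \<epsilon> * (b c - sum (a c) (X t))"
      if "c \<in> C" "i \<in> J - (X t \<union> K (X t))" for c i
      using that by (auto simp: K_def large_items_def not_less)
  qed (use X_sub K_sub t_val in auto)
qed

theorem theorem3:
  fixes V :: "'a vmgap" and J :: "'a set" and P :: "nat \<Rightarrow> 'a set" and \<epsilon> :: real
  assumes "vmgap_instance V"
    and "feasible V J P"
    and "\<epsilon> > 0"
  shows "\<exists>X Y. X \<subseteq> J \<and> Y \<subseteq> J \<and>
    real (card X) \<le> (real (num_dims V) + real (num_machines V)) / \<epsilon>\<^sup>2 \<and>
    set_val V P Y \<le> \<epsilon> * set_val V P J \<and>
    (\<forall>j\<in>machines V. \<forall>i\<in>P j - (X \<union> Y).
       item_size V j i \<le> \<epsilon> * (capacity V j - set_size V j (X \<inter> P j))) \<and>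
    (\<forall>i\<in>J - (X \<union> Y). \<forall>q\<in>dims V.
       item_weight V q i \<le> \<epsilon> * (weight_bound V q - set_weight V q X))"
proof -
  define C where "C = machines V <+> dims V"
  \<comment> \<open>An item consumes nothing on machines other than its own, so summing over any
    subset of \<open>J\<close> measures only its part in \<open>P j\<close>. Likewise
    \<open>v\<close> turns the assignment-dependent value into a plain item value.\<close>
  define a where "a = case_sum (\<lambda>j i. if i \<in> P j then item_size V j i else 0) (item_weight V)"
  define b where "b = case_sum (capacity V) (weight_bound V)"
  define v where "v i = (\<Sum>j\<in>machines V. if i \<in> P j then item_val V j i else 0)" for i
  have J_sub: "J \<subseteq> items V" and P_sub: "\<And>j. j \<in> machines V \<Longrightarrow> P j \<subseteq> J"
    using assms(2) by (auto simp: feasible_def)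
  have "finite J"
    using assms(1) J_sub by (auto simp: vmgap_instance_def intro: finite_subset)
  have size: "sum (a (Inl j)) S = set_size V j (S \<inter> P j)" if "S \<subseteq> J" for S j
    using finite_subset[OF that \<open>finite J\<close>]
    by (simp add: a_def set_size_def sum.inter_restrict)
  have weight: "sum (a (Inr q)) S = set_weight V q S" for S q
    by (simp add: a_def set_weight_def)
  have val: "sum v S = set_val V P S" if "S \<subseteq> J" for S
    unfolding v_def set_val_def
    using finite_subset[OF that \<open>finite J\<close>]
    \<comment> \<open>Exchanging the sums groups the item values by machine.\<close>
    by (subst sum.swap) (simp add: sum.inter_restrict)
  have "finite C"
    by (simp add: C_def machines_def dims_def)
  have card_C: "card C = num_machines V + num_dims V"
    by (simp add: C_def machines_def dims_def card_Plus)
  obtain X Y where X: "X \<subseteq> J" and Y: "Y \<subseteq> J"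
    and card: "real (card X) \<le> real (card C) / \<epsilon>\<^sup>2"
    and small: "sum v Y \<le> \<epsilon> * sum v J"
    and fits: "\<And>c i. c \<in> C \<Longrightarrow> i \<in> J - (X \<union> Y) \<Longrightarrow> a c i \<le> \<epsilon> * (b c - sum (a c) X)"
  proof (rule exists_small_large_items[OF \<open>finite J\<close> \<open>finite C\<close> \<open>\<epsilon> > 0\<close>, of a b v])
    show "a c i \<ge> 0" if "c \<in> C" "i \<in> J" for c i
      using that assms(1) J_sub by (auto simp: C_def a_def vmgap_instance_def)
    show "sum (a c) J \<le> b c" if "c \<in> C" for c
      using that assms(2) P_sub
      by (auto simp: C_def b_def size weight feasible_def Int_absorb1)
    show "v i \<ge> 0" if "i \<in> J" for i
      using that assms(1) J_sub by (auto simp: v_def vmgap_instance_def intro!: sum_nonneg)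
  qed blast
  have "item_size V j i \<le> \<epsilon> * (capacity V j - set_size V j (X \<inter> P j))"
    if "j \<in> machines V" "i \<in> P j - (X \<union> Y)" for i j
    using that fits[of "Inl j" i] P_sub size[OF X] by (auto simp: C_def a_def b_def)
  moreover have "item_weight V q i \<le> \<epsilon> * (weight_bound V q - set_weight V q X)"
    if "q \<in> dims V" "i \<in> J - (X \<union> Y)" for q i
    using that fits[of "Inr q" i] weight by (auto simp: C_def a_def b_def)
  moreover have "set_val V P Y \<le> \<epsilon> * set_val V P J"
    using small by (simp add: val Y)
  moreover have "real (card X) \<le> (real (num_dims V) + real (num_machines V)) / \<epsilon>\<^sup>2"
    using card by (simp add: card_C add.commute)
  ultimately show ?thesis
    using X Y by blast
qed

end
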